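(* Let $(\mathcal{X},\mathcal{D})$ be a complete metric space and let $f:\mathcal{X}\to\mathcal{X}$ be a self map such that $\mathcal{D}_f(x)<\infty$ for every $x\in\mathcal{X}$. Suppose that $f$ is a generalized contraction of type (III), i.e. there exists $\phi\in\Phi$ such that $$\mathcal{D}(fx,fy)\leq \max\Big\{\phi(\mathcal{D}_{f}(x)),\ \phi(\mathcal{D}_{f}(y)),\ \phi(\mathcal{D}_{f}(x,y)),\ \phi\Big(\frac{\mathcal{D}_{f}(x)+\mathcal{D}_{f}(y)}{2}\Big)\Big\}$$ for all $x,y\in\mathcal{X}$. Then $f$ has a unique fixed point. Moreover, for each $x\in\mathcal{X}$, the sequence $(f^{n}x)$ converges to a fixed point of $f$.
   Context: For a self map $f$ on a metric space $(\mathcal{X},\mathcal{D})$: $O_f(x)=\{x,fx,f^2x,\dots\}$ is the set of iterates of $f$ at $x$; $\mathcal{D}_f(x)=\sup\{\mathcal{D}(u,v):u,v\in O_f(x)\}$; $\mathcal{D}_f(x,y)=\sup\{\mathcal{D}(u,v):u,v\in O_f(x)\cup O_f(y)\}$. It is assumed throughout that $\mathcal{D}_f(x)$ is finite for each $x\in\mathcal{X}$. $\Phi$ is the collection of all functions $\phi:[0,\infty)\to[0,\infty)$ such that (1) $\phi(t)<t$ for each $t>0$; and (2) for each $\epsilon>0$ there exists $\mathfrak{d}>0$ such that $\phi(t)\leq\epsilon$ for every $t\in(\epsilon,\epsilon+\mathfrak{d})$.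
   Formalization: Uniqueness of the fixed point is proved only when φ(0)=0, since Φ allows φ(0)>0 and then it can fail (identity on two points at distance 1, φ(0)=1, φ(t)=t/2 for t>0); existence and convergence are proved for all φ in Φ. *)

theory Defs
  imports "HOL-Analysis.Analysis"
begin

definition iterates :: "('a \<Rightarrow> 'a) \<Rightarrow> 'a \<Rightarrow> 'a set" where
  "iterates f x = range (\<lambda>n. (f ^^ n) x)"

(* "diameter S" is the real-valued supremum of the distances between points of S, a meaningful
   value only when these distances are bounded above.  If they are on the orbits of x and of y,
   they are on the union of the two orbits, so orbit_diam2 needs no boundedness assumption
   beyond the one for orbit_diam. *)
definition orbit_diam :: "('a::metric_space \<Rightarrow> 'a) \<Rightarrow> 'a \<Rightarrow> real" where
  "orbit_diam f x = diameter (iterates f x)"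

definition orbit_diam2 :: "('a::metric_space \<Rightarrow> 'a) \<Rightarrow> 'a \<Rightarrow> 'a \<Rightarrow> real" where
  "orbit_diam2 f x y = diameter (iterates f x \<union> iterates f y)"

definition finite_orbit_diam :: "('a::metric_space \<Rightarrow> 'a) \<Rightarrow> 'a \<Rightarrow> bool" where
  "finite_orbit_diam f x \<longleftrightarrow>
     bdd_above {dist u v | u v. u \<in> iterates f x \<and> v \<in> iterates f x}"

(* A function from [0, oo) to [0, oo) is rendered as a function on the reals whose values at
   negative arguments are irrelevant.  The value at 0 is only required to be nonnegative. *)
definition Phi :: "(real \<Rightarrow> real) set" where
  "Phi = {\<phi>. (\<forall>t\<ge>0. \<phi> t \<ge> 0) \<and>
              (\<forall>t>0. \<phi> t < t) \<and>
              (\<forall>\<epsilon>>0. \<exists>\<delta>>0. \<forall>t\<in>{\<epsilon><..<\<epsilon>+\<delta>}. \<phi> t \<le> \<epsilon>)}"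

(* f is a generalized contraction of type (III) when this holds for some \<phi> in Phi. *)
definition gen_contraction_III :: "(real \<Rightarrow> real) \<Rightarrow> ('a::metric_space \<Rightarrow> 'a) \<Rightarrow> bool" where
  "gen_contraction_III \<phi> f \<longleftrightarrow>
     (\<forall>x y. dist (f x) (f y) \<le>
        Max {\<phi> (orbit_diam f x), \<phi> (orbit_diam f y), \<phi> (orbit_diam2 f x y),
             \<phi> ((orbit_diam f x + orbit_diam f y) / 2)})"

(* Members of Phi may have a positive value at 0, and then uniqueness of the fixed point fails:
   on a two-point space the identity map satisfies gen_contraction_III \<phi> for \<phi> t = t/2 (t > 0) and
   \<phi> 0 at least the distance of the two points, because both orbits have diameter 0.  Uniqueness
   therefore has to be stated under the condition \<phi> 0 = 0; existence and convergence do not need it. *)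

end

theory Submission
  imports Defs
begin

text \<open>
  Write \<open>D k\<close> for the diameter of the orbit of \<open>f\<^sup>k z\<close>.  In the contraction condition for \<open>f\<^sup>m z\<close> and
  \<open>f\<^sup>n z\<close>, the four arguments of \<open>\<phi>\<close> all lie between \<open>D m\<close> and \<open>D n\<close>, so if \<open>D\<close> decreased to
  some \<open>\<epsilon> > 0\<close>, the second property of \<open>\<phi>\<close> would bring \<open>D\<close> down to exactly \<open>\<epsilon>\<close> after finitely many
  steps, and \<open>\<phi> \<epsilon> < \<epsilon>\<close> would bring it below \<open>\<epsilon>\<close> (lemma \<open>orbit_diam_tendsto_0\<close>).  Hence all orbits
  are Cauchy.

  The delicate part is that the limit \<open>z\<close> of an orbit \<open>f\<^sup>n x\<close> is fixed, since \<open>f\<close> need not be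
  continuous.  Suppose it is not, so that \<open>D 0 > 0\<close>.  The diameters \<open>t n\<close> of the union of the orbits of
  \<open>f\<^sup>n x\<close> and of \<open>z\<close> tend to \<open>D 0\<close> from above; once they are close to it, the second
  property of \<open>\<phi>\<close> makes them equal to \<open>D 0\<close> (lemma \<open>orbit_diam2_eventually_eq\<close>).  In the
  contraction condition for \<open>f\<^sup>n x\<close> and \<open>z\<close>, the term \<open>\<phi> (t n)\<close> therefore becomes \<open>\<phi> (D 0)\<close>, a
  bound less than \<open>D 0\<close> that does not depend on \<open>n\<close>.  In the limit this bounds the distance from \<open>z\<close>
  to \<open>f z\<close>.  The same works one by one for the distances from \<open>z\<close> to
  \<open>f\<^sup>j z\<close>: as long as the earlier ones do not exceed a constant \<open>c < D 0\<close>, the diameter \<open>D 0\<close> must be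
  caused by the later ones, which keeps the relevant joint diameter equal to \<open>D 0\<close>.  As
  also \<open>D 1 < D 0\<close> (lemma \<open>orbit_diam_image_less\<close>), all distances in the orbit of \<open>z\<close> are at most some
  \<open>c < D 0\<close>, which is absurd.

  A recurring nuisance is that \<open>\<phi> 0\<close> may be positive, so that the condition says little about points
  that are already fixed.  If the orbit of \<open>x\<close> reaches a fixed point, this point is its limit; for
  the orbit of \<open>z\<close>, lemma \<open>iterate_as_image_of_nonfixed\<close> represents every \<open>f\<^sup>j z\<close> with \<open>j > 0\<close> as
  the image of an iterate that is not fixed.
\<close>

section \<open>Diameters of orbits\<close>

lemma funpow_funpow: "(f ^^ m) ((f ^^ n) x) = (f ^^ (m + n)) x"
  by (simp add: funpow_add)

locale generalized_contraction =
  fixes f :: "'a::metric_space \<Rightarrow> 'a" and \<phi> :: "real \<Rightarrow> real"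
  assumes finite_diam: "\<And>x. finite_orbit_diam f x"
    and Phi: "\<phi> \<in> Phi"
    and contraction: "gen_contraction_III \<phi> f"
begin

lemma bounded_iterates: "bounded (iterates f x)"
proof -
  obtain B where "\<And>u v. u \<in> iterates f x \<Longrightarrow> v \<in> iterates f x \<Longrightarrow> dist u v \<le> B"
    using finite_diam[of x] unfolding finite_orbit_diam_def bdd_above_def by blast
  then show ?thesis
    unfolding bounded_def by (metis iterates_def rangeI)
qed

lemma dist_iterates_le: "dist ((f ^^ i) x) ((f ^^ j) x) \<le> orbit_diam f x"
  unfolding orbit_diam_def
  by (rule diameter_bounded_bound[OF bounded_iterates]) (auto simp: iterates_def)

lemma dist_iterates_le2: "dist ((f ^^ i) x) ((f ^^ j) y) \<le> orbit_diam2 f x y"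
proof -
  have "(f ^^ i) x \<in> iterates f x" "(f ^^ j) y \<in> iterates f y" by (auto simp: iterates_def)
  then show ?thesis
    unfolding orbit_diam2_def by (intro diameter_bounded_bound) (auto simp: bounded_iterates)
qed

lemma orbit_diam_nonneg: "0 \<le> orbit_diam f x"
  unfolding orbit_diam_def by (rule diameter_ge_0[OF bounded_iterates])

lemma orbit_diam_leI:
  assumes "\<And>i j. i \<le> j \<Longrightarrow> dist ((f ^^ i) x) ((f ^^ j) x) \<le> c"
  shows "orbit_diam f x \<le> c"
proof -
  have "dist ((f ^^ i) x) ((f ^^ j) x) \<le> c" for i j
    using assms[of i j] assms[of j i] by (cases "i \<le> j") (auto simp: dist_commute)
  then show ?thesis
    unfolding orbit_diam_def diameter_def
    by (auto simp: iterates_def intro!: cSUP_least)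
qed

lemma orbit_diam2_leI:
  assumes "orbit_diam f x \<le> c" "orbit_diam f y \<le> c"
    and "\<And>i j. dist ((f ^^ i) x) ((f ^^ j) y) \<le> c"
  shows "orbit_diam2 f x y \<le> c"
proof -
  have "dist u v \<le> c" if "u \<in> iterates f x \<union> iterates f y" "v \<in> iterates f x \<union> iterates f y" for u v
    using that assms order_trans[OF dist_iterates_le assms(1)] order_trans[OF dist_iterates_le assms(2)]
    by (auto simp: iterates_def dist_commute[of "(f ^^ _) y" "(f ^^ _) x"])
  moreover have "iterates f x \<noteq> {}" by (auto simp: iterates_def)
  ultimately show ?thesis
    unfolding orbit_diam2_def diameter_def by (auto intro!: cSUP_least)
qed

lemma iterates_funpow_subset: "m \<le> n \<Longrightarrow> iterates f ((f ^^ n) x) \<subseteq> iterates f ((f ^^ m) x)"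
proof -
  assume "m \<le> n"
  then have "(f ^^ i) ((f ^^ n) x) = (f ^^ (i + n - m)) ((f ^^ m) x)" for i
    by (simp add: funpow_funpow)
  then show ?thesis by (auto simp: iterates_def)
qed

lemma orbit_diam_antimono: "m \<le> n \<Longrightarrow> orbit_diam f ((f ^^ n) x) \<le> orbit_diam f ((f ^^ m) x)"
  unfolding orbit_diam_def by (intro diameter_subset iterates_funpow_subset bounded_iterates)

lemma orbit_diam2_antimono:
  assumes "m \<le> n" "k \<le> l"
  shows "orbit_diam2 f ((f ^^ n) x) ((f ^^ l) y) \<le> orbit_diam2 f ((f ^^ m) x) ((f ^^ k) y)"
  unfolding orbit_diam2_def
  using assms by (intro diameter_subset Un_mono iterates_funpow_subset) (auto simp: bounded_iterates)

lemma orbit_diam_le_orbit_diam2: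
  "orbit_diam f x \<le> orbit_diam2 f x y" "orbit_diam f y \<le> orbit_diam2 f x y"
  unfolding orbit_diam_def orbit_diam2_def
  by (intro diameter_subset; simp add: bounded_iterates)+

lemma orbit_diam2_iterates:
  "m \<le> n \<Longrightarrow> orbit_diam2 f ((f ^^ m) x) ((f ^^ n) x) = orbit_diam f ((f ^^ m) x)"
  using iterates_funpow_subset[of m n x] by (simp add: orbit_diam2_def orbit_diam_def Un_absorb2)

lemma fixed_iff_orbit_diam_0: "f x = x \<longleftrightarrow> orbit_diam f x = 0"
proof
  assume "f x = x"
  then have "(f ^^ n) x = x" for n by (induction n) auto
  then show "orbit_diam f x = 0" by (simp add: orbit_diam_def iterates_def)
next
  assume "orbit_diam f x = 0"
  then show "f x = x" using dist_iterates_le[of 1 x 0] by simp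
qed

lemma orbit_diam_pos: "f x \<noteq> x \<Longrightarrow> 0 < orbit_diam f x"
  using fixed_iff_orbit_diam_0[of x] orbit_diam_nonneg[of x] by linarith

section \<open>The contraction condition\<close>

lemma phi_less: "0 < t \<Longrightarrow> \<phi> t < t"
  using Phi by (simp add: Phi_def)

lemma phi_le: "0 < t \<Longrightarrow> t \<le> c \<Longrightarrow> \<phi> t \<le> c"
  using phi_less[of t] by linarith

lemma phi_le_right:
  assumes "0 < \<epsilon>"
  obtains \<delta> where "0 < \<delta>" "\<And>t. 0 < t \<Longrightarrow> t < \<epsilon> + \<delta> \<Longrightarrow> \<phi> t \<le> \<epsilon>"
proof -
  obtain \<delta> where "\<delta> > 0" and \<delta>: "\<forall>t\<in>{\<epsilon><..<\<epsilon>+\<delta>}. \<phi> t \<le> \<epsilon>"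
    using Phi assms by (auto simp: Phi_def)
  have "\<phi> t \<le> \<epsilon>" if "0 < t" "t < \<epsilon> + \<delta>" for t
    using \<delta> phi_le[of t \<epsilon>] that by (cases "t \<le> \<epsilon>") auto
  then show thesis using that \<open>\<delta> > 0\<close> by blast
qed

lemma dist_image_leI:
  assumes "\<phi> (orbit_diam f x) \<le> c" "\<phi> (orbit_diam f y) \<le> c" "\<phi> (orbit_diam2 f x y) \<le> c"
    "\<phi> ((orbit_diam f x + orbit_diam f y) / 2) \<le> c"
  shows "dist (f x) (f y) \<le> c"
proof -
  have "dist (f x) (f y) \<le> Max {\<phi> (orbit_diam f x), \<phi> (orbit_diam f y), \<phi> (orbit_diam2 f x y),
             \<phi> ((orbit_diam f x + orbit_diam f y) / 2)}"
    using contraction unfolding gen_contraction_III_def by blast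
  also have "\<dots> \<le> c" using assms by simp
  finally show ?thesis .
qed

text \<open>The bounds \<open>\<phi> t \<le> t\<close> are available only for \<open>t > 0\<close>, so the contraction condition is useful only
  at points that are not fixed.  To apply it to \<open>f\<^sup>j z\<close>, decrease \<open>j\<close> as long as the predecessor is
  fixed; this does not change the iterate, and it ends at a positive index because \<open>z\<close> is not
  fixed.\<close>

lemma iterate_as_image_of_nonfixed:
  assumes "f z \<noteq> z" "0 < j"
  obtains m where "m < j" "(f ^^ j) z = f ((f ^^ m) z)" "0 < orbit_diam f ((f ^^ m) z)"
proof -
  have "\<exists>m<j. (f ^^ j) z = f ((f ^^ m) z) \<and> f ((f ^^ m) z) \<noteq> (f ^^ m) z"
    using assms(2)
  proof (induction j)
    case (Suc j)
    show ?case
    proof (cases "f ((f ^^ j) z) = (f ^^ j) z")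
      case True
      then have "0 < j" using assms(1) by (cases j) auto
      with Suc.IH True show ?thesis by (metis funpow.simps(2) comp_apply less_SucI)
    qed auto
  qed simp
  then show thesis using that orbit_diam_pos by blast
qed

section \<open>Orbits are Cauchy sequences\<close>

lemma orbit_diam_tendsto_0: "(\<lambda>n. orbit_diam f ((f ^^ n) x)) \<longlonglongrightarrow> 0"
proof -
  define d where "d n = orbit_diam f ((f ^^ n) x)" for n
  have dec: "d n \<le> d m" if "m \<le> n" for m n
    using orbit_diam_antimono[OF that] by (simp add: d_def)
  have "decseq d" using dec by (simp add: decseq_def)
  moreover have "0 \<le> d n" for n by (simp add: d_def orbit_diam_nonneg)
  ultimately obtain \<epsilon> where lim: "d \<longlonglongrightarrow> \<epsilon>" and ge: "\<And>n. \<epsilon> \<le> d n"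
    using decseq_convergent[of d 0] by metis
  have "0 \<le> \<epsilon>" using lim \<open>\<And>n. 0 \<le> d n\<close> by (meson LIMSEQ_le_const)
  have Suc_le: "d (Suc n) \<le> c" if "\<And>t. \<epsilon> \<le> t \<Longrightarrow> t \<le> d n \<Longrightarrow> \<phi> t \<le> c" for n c
    unfolding d_def
  proof (rule orbit_diam_leI)
    fix i j :: nat assume "i \<le> j"
    have "dist (f ((f ^^ (n + i)) x)) (f ((f ^^ (n + j)) x)) \<le> c"
    proof (rule dist_image_leI)
      show "\<phi> (orbit_diam f ((f ^^ (n + i)) x)) \<le> c" "\<phi> (orbit_diam f ((f ^^ (n + j)) x)) \<le> c"
        "\<phi> ((orbit_diam f ((f ^^ (n + i)) x) + orbit_diam f ((f ^^ (n + j)) x)) / 2) \<le> c"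
        using ge[of "n+i"] ge[of "n+j"] dec[of n "n+i"] dec[of n "n+j"]
        by (intro that; simp add: d_def)+
      then show "\<phi> (orbit_diam2 f ((f ^^ (n + i)) x) ((f ^^ (n + j)) x)) \<le> c"
        using \<open>i \<le> j\<close> by (simp add: orbit_diam2_iterates)
    qed
    then show "dist ((f ^^ i) ((f ^^ Suc n) x)) ((f ^^ j) ((f ^^ Suc n) x)) \<le> c"
      by (simp add: funpow_add funpow_swap1 add.commute[of n])
  qed
  have "\<epsilon> = 0"
  proof (rule ccontr)
    assume "\<epsilon> \<noteq> 0"
    with \<open>0 \<le> \<epsilon>\<close> have "0 < \<epsilon>" by simp
    then obtain \<delta> where "0 < \<delta>" and \<delta>: "\<And>t. 0 < t \<Longrightarrow> t < \<epsilon> + \<delta> \<Longrightarrow> \<phi> t \<le> \<epsilon>"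
      using phi_le_right by blast
    have "eventually (\<lambda>n. d n < \<epsilon> + \<delta>) sequentially"
      using order_tendstoD(2)[OF lim] \<open>0 < \<delta>\<close> by simp
    then obtain N where "d N < \<epsilon> + \<delta>" by (auto simp: eventually_sequentially)
    then have "d (Suc N) \<le> \<epsilon>" using \<delta> \<open>0 < \<epsilon>\<close> by (intro Suc_le) auto
    then have "d (Suc N) = \<epsilon>" using ge by (metis antisym)
    then have "d (Suc (Suc N)) \<le> \<phi> \<epsilon>" by (intro Suc_le) auto
    then show False using phi_less[OF \<open>0 < \<epsilon>\<close>] ge[of "Suc (Suc N)"] by linarith
  qed
  with lim show ?thesis by (simp add: d_def[abs_def])
qed

lemma Cauchy_iterates: "Cauchy (\<lambda>n. (f ^^ n) x)"
proof (rule metric_CauchyI)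
  fix e :: real assume "0 < e"
  then obtain N where N: "orbit_diam f ((f ^^ N) x) < e"
    using eventually_happens'[OF sequentially_bot order_tendstoD(2)[OF orbit_diam_tendsto_0]] by blast
  have "dist ((f ^^ m) x) ((f ^^ n) x) < e" if "N \<le> m" "N \<le> n" for m n
    using dist_iterates_le[of "m - N" "(f ^^ N) x" "n - N"] N that
    by (simp add: funpow_funpow)
  then show "\<exists>M. \<forall>m\<ge>M. \<forall>n\<ge>M. dist ((f ^^ m) x) ((f ^^ n) x) < e" by blast
qed

section \<open>Limits of orbits are fixed points\<close>

text \<open>Let \<open>D\<^sub>k\<close> be the orbit diameter of \<open>f\<^sup>k z\<close> and \<open>m\<close> the first index with \<open>D\<^sub>m < D\<^sub>0\<close>.  For two iterates that are not fixed, with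
  indices \<open>k \<le> l\<close>, the diameters \<open>D\<^sub>k\<close> and \<open>D\<^sub>l\<close> are each equal to \<open>D\<^sub>0\<close> or at most \<open>D\<^sub>m\<close>, their mean is
  equal to \<open>D\<^sub>0\<close> or at most \<open>(D\<^sub>0 + D\<^sub>m) / 2\<close>, and the joint diameter is \<open>D\<^sub>k\<close>.  The distance
  between the images is therefore at most \<open>\<phi> D\<^sub>0\<close> or at most \<open>(D\<^sub>0 + D\<^sub>m) / 2\<close>, which is a uniform
  bound below \<open>D\<^sub>0\<close>; mere pointwise inequalities would not bound the supremum.\<close>

lemma orbit_diam_image_less:
  assumes "f z \<noteq> z"
  shows "orbit_diam f (f z) < orbit_diam f z"
proof -
  define d where "d n = orbit_diam f ((f ^^ n) z)" for n
  have dec: "d n \<le> d m" if "m \<le> n" for m n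
    using orbit_diam_antimono[OF that] by (simp add: d_def)
  have "0 < d 0" using orbit_diam_pos[OF assms] by (simp add: d_def)
  then have ex: "\<exists>n. d n < d 0"
    using eventually_happens'[OF sequentially_bot order_tendstoD(2)[OF orbit_diam_tendsto_0[of z]]]
    by (simp add: d_def)
  define m where "m = (LEAST n. d n < d 0)"
  have m: "d m < d 0" unfolding m_def using ex by (rule LeastI_ex)
  have full: "d i = d 0" if "i < m" for i
    using not_less_Least[of i "\<lambda>n. d n < d 0"] dec[of 0 i] that by (simp add: m_def)
  define c where "c = max (\<phi> (d 0)) ((d 0 + d m) / 2)"
  have "c < d 0" using m phi_less[OF \<open>0 < d 0\<close>] by (simp add: c_def)
  have phi_d: "\<phi> (d i) \<le> c" if "0 < d i" for i
  proof (cases "i < m")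
    case True
    then show ?thesis by (simp add: full[OF True] c_def)
  next
    case False
    then have "d i \<le> c" using dec[of m i] m by (simp add: c_def le_max_iff_disj)
    with that show ?thesis by (rule phi_le)
  qed
  have pair: "dist (f ((f ^^ i) z)) (f ((f ^^ j) z)) \<le> c"
    if "i \<le> j" "0 < d i" "0 < d j" for i j
  proof (rule dist_image_leI)
    show "\<phi> (orbit_diam f ((f ^^ i) z)) \<le> c" "\<phi> (orbit_diam f ((f ^^ j) z)) \<le> c"
      "\<phi> (orbit_diam2 f ((f ^^ i) z) ((f ^^ j) z)) \<le> c"
      using phi_d[of i] phi_d[of j] that by (simp_all add: orbit_diam2_iterates d_def)
    have "\<phi> ((d i + d j) / 2) \<le> c"
    proof (cases "j < m")
      case True
      then have "d i = d 0" "d j = d 0" using full[of i] full[of j] \<open>i \<le> j\<close> by auto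
      then show ?thesis by (simp add: c_def)
    next
      case False
      then have "(d i + d j) / 2 \<le> c" using dec[of m j] dec[of 0 i] by (simp add: c_def le_max_iff_disj)
      then show ?thesis using that by (intro phi_le) auto
    qed
    then show "\<phi> ((orbit_diam f ((f ^^ i) z) + orbit_diam f ((f ^^ j) z)) / 2) \<le> c"
      by (simp add: d_def)
  qed
  have "orbit_diam f (f z) \<le> c"
  proof (rule orbit_diam_leI)
    fix i j
    obtain k where k: "(f ^^ Suc i) z = f ((f ^^ k) z)" "0 < d k"
      using iterate_as_image_of_nonfixed[OF assms, of "Suc i"] unfolding d_def by blast
    obtain l where l: "(f ^^ Suc j) z = f ((f ^^ l) z)" "0 < d l"
      using iterate_as_image_of_nonfixed[OF assms, of "Suc j"] unfolding d_def by blast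
    have "dist ((f ^^ Suc i) z) ((f ^^ Suc j) z) \<le> c"
      unfolding k(1) l(1) using pair[of k l] pair[of l k] k(2) l(2)
      by (cases "k \<le> l") (auto simp: dist_commute)
    then show "dist ((f ^^ i) (f z)) ((f ^^ j) (f z)) \<le> c" by (simp add: funpow_swap1)
  qed
  then show ?thesis using \<open>c < d 0\<close> by (simp add: d_def)
qed

text \<open>The joint diameters approach \<open>orbit_diam f z\<close> from above, and the distances between
  images are controlled by \<open>\<phi>\<close> of these joint diameters; so the second property of \<open>\<phi>\<close> removes the
  excess in a single step.  Distances to \<open>z\<close> itself, which need not be an image, are small
  because of the convergence.\<close>

lemma orbit_diam2_eventually_eq:
  assumes lim: "(\<lambda>n. (f ^^ n) x) \<longlonglongrightarrow> z" and "f z \<noteq> z" and nonfixed: "\<And>n. f ((f ^^ n) x) \<noteq> (f ^^ n) x"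
  shows "eventually (\<lambda>n. orbit_diam2 f ((f ^^ n) x) z = orbit_diam f z) sequentially"
proof -
  define D where "D = orbit_diam f z"
  define d where "d n = orbit_diam f ((f ^^ n) x)" for n
  have "0 < D" using orbit_diam_pos \<open>f z \<noteq> z\<close> by (simp add: D_def)
  have tail_le: "orbit_diam f ((f ^^ m) z) \<le> D" for m
    using orbit_diam_antimono[of 0 m z] by (simp add: D_def)
  obtain \<delta> where "0 < \<delta>" and \<delta>: "\<And>t. 0 < t \<Longrightarrow> t < D + \<delta> \<Longrightarrow> \<phi> t \<le> D"
    using phi_le_right[OF \<open>0 < D\<close>] by blast
  have "eventually (\<lambda>n. d n < D) sequentially"
    using order_tendstoD(2)[OF orbit_diam_tendsto_0 \<open>0 < D\<close>] by (simp add: d_def)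
  moreover have "eventually (\<lambda>n. dist ((f ^^ n) x) z < min D (\<delta> / 2)) sequentially"
    using tendstoD[OF lim, of "min D (\<delta> / 2)"] \<open>0 < D\<close> \<open>0 < \<delta>\<close> by simp
  ultimately have "eventually (\<lambda>n. d n < D \<and> dist ((f ^^ n) x) z < min D (\<delta> / 2)) sequentially"
    by (rule eventually_conj)
  then obtain N where N: "\<And>n. N \<le> n \<Longrightarrow> d n < D" "\<And>n. N \<le> n \<Longrightarrow> dist ((f ^^ n) x) z < D"
      "\<And>n. N \<le> n \<Longrightarrow> dist ((f ^^ n) x) z < \<delta> / 2"
    by (auto simp: eventually_sequentially)
  have near: "orbit_diam2 f ((f ^^ n) x) z < D + \<delta>" if "N \<le> n" for n
  proof -
    have "orbit_diam2 f ((f ^^ n) x) z \<le> D + \<delta> / 2"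
    proof (rule orbit_diam2_leI)
      fix i j
      show "dist ((f ^^ i) ((f ^^ n) x)) ((f ^^ j) z) \<le> D + \<delta> / 2"
        using dist_triangle[of "(f ^^ (i + n)) x" "(f ^^ j) z" z] N(3)[of "i + n"] that
          dist_iterates_le[of 0 z j] by (simp add: funpow_add D_def)
    qed (use N(1)[OF that] \<open>0 < \<delta>\<close> in \<open>auto simp: D_def d_def\<close>)
    then show ?thesis using \<open>0 < \<delta>\<close> by simp
  qed
  have "orbit_diam2 f ((f ^^ n) x) z \<le> D" if "Suc N \<le> n" for n
  proof (rule orbit_diam2_leI)
    show "orbit_diam f ((f ^^ n) x) \<le> D" using N(1)[of n] that by (simp add: d_def)
    show "orbit_diam f z \<le> D" by (simp add: D_def)
    fix i j
    show "dist ((f ^^ i) ((f ^^ n) x)) ((f ^^ j) z) \<le> D"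
    proof (cases "j = 0")
      case True
      then show ?thesis using N(2)[of "i + n"] that by (simp add: funpow_add)
    next
      case False
      then obtain m where m: "(f ^^ j) z = f ((f ^^ m) z)" "0 < orbit_diam f ((f ^^ m) z)"
        using iterate_as_image_of_nonfixed[OF \<open>f z \<noteq> z\<close>] by blast
      obtain k where k: "i + n = Suc k" "N \<le> k"
        using \<open>Suc N \<le> n\<close> by (metis Suc_le_D Suc_le_mono trans_le_add2)
      have "0 < d k" using orbit_diam_pos nonfixed by (simp add: d_def)
      have "d k < D" using N(1) k by simp
      have "dist (f ((f ^^ k) x)) (f ((f ^^ m) z)) \<le> D"
      proof (rule dist_image_leI)
        show "\<phi> (orbit_diam f ((f ^^ k) x)) \<le> D" "\<phi> (orbit_diam f ((f ^^ m) z)) \<le> D"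
          "\<phi> ((orbit_diam f ((f ^^ k) x) + orbit_diam f ((f ^^ m) z)) / 2) \<le> D"
          using \<open>0 < d k\<close> \<open>d k < D\<close> m(2) tail_le[of m] by (intro phi_le; simp add: d_def)+
        have "orbit_diam2 f ((f ^^ k) x) ((f ^^ m) z) < D + \<delta>"
          using near[OF k(2)] orbit_diam2_antimono[of k k 0 m x z] by simp
        moreover have "0 < orbit_diam2 f ((f ^^ k) x) ((f ^^ m) z)"
          using m(2) orbit_diam_le_orbit_diam2(2) by (rule less_le_trans)
        ultimately show "\<phi> (orbit_diam2 f ((f ^^ k) x) ((f ^^ m) z)) \<le> D" by (intro \<delta>)
      qed
      moreover have "(f ^^ i) ((f ^^ n) x) = f ((f ^^ k) x)"
        using k(1) by (metis comp_apply funpow.simps(2) funpow_add)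
      ultimately show ?thesis by (simp add: m(1))
    qed
  qed
  then have "orbit_diam2 f ((f ^^ n) x) z = D" if "Suc N \<le> n" for n
    using that orbit_diam_le_orbit_diam2(2)[of z "(f ^^ n) x"] by (metis D_def antisym)
  then show ?thesis unfolding D_def eventually_sequentially by blast
qed

text \<open>If \<open>z\<close> is not fixed, all distances from \<open>z\<close> to its later iterates stay below a constant
  less than \<open>orbit_diam f z\<close>.  This is shown by strong induction on the index, because the
  joint diameter in the contraction condition is known to be \<open>orbit_diam f z\<close> only once
  the earlier distances are known to be too small to account for it.\<close>

lemma limit_of_iterates_fixed:
  assumes lim: "(\<lambda>n. (f ^^ n) x) \<longlonglongrightarrow> z"
  shows "f z = z"
proof (cases "\<exists>n. f ((f ^^ n) x) = (f ^^ n) x")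
  case True
  then obtain n where n: "f ((f ^^ n) x) = (f ^^ n) x" by blast
  have "(f ^^ (k + n)) x = (f ^^ n) x" for k by (induction k) (simp_all add: n)
  then have "(\<lambda>k. (f ^^ n) x) \<longlonglongrightarrow> z" using LIMSEQ_ignore_initial_segment[OF lim, of n] by simp
  then show ?thesis using n LIMSEQ_unique[OF tendsto_const] by metis
next
  case False
  then have nonfixed: "\<And>n. f ((f ^^ n) x) \<noteq> (f ^^ n) x" by blast
  define D where "D = orbit_diam f z"
  show ?thesis
  proof (rule ccontr)
    assume "f z \<noteq> z"
    then have "0 < D" using orbit_diam_pos by (simp add: D_def)
    \<comment> \<open>\<open>3 * D / 4\<close> is the mean of \<open>D\<close> and \<open>D / 2\<close>, where \<open>D / 2\<close> will bound the diameters of late orbits of \<open>x\<close>.\<close>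
    define c where "c = max (\<phi> D) (max (3 * D / 4) (orbit_diam f (f z)))"
    have "c < D"
      using phi_less[OF \<open>0 < D\<close>] \<open>0 < D\<close> orbit_diam_image_less[OF \<open>f z \<noteq> z\<close>] by (simp add: c_def D_def)
    have c: "\<phi> D \<le> c" "3 * D / 4 \<le> c" "orbit_diam f (f z) \<le> c" by (auto simp: c_def)
    have tail_le: "orbit_diam f ((f ^^ m) z) \<le> D" for m
      using orbit_diam_antimono[of 0 m z] by (simp add: D_def)
    \<comment> \<open>Up to \<open>c\<close>, only the distances from \<open>z\<close> itself count for the diameter.\<close>
    have D_le: "D \<le> b" if "c \<le> b" "\<And>i. 0 < i \<Longrightarrow> dist z ((f ^^ i) z) \<le> b" for b
      unfolding D_def
    proof (rule orbit_diam_leI)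
      fix i j :: nat assume "i \<le> j"
      show "dist ((f ^^ i) z) ((f ^^ j) z) \<le> b"
      proof (cases "i = 0")
        case True
        then show ?thesis using that \<open>c < D\<close> orbit_diam_nonneg[of "f z"] c(3)
          by (cases "j = 0") auto
      next
        case False
        then obtain k l where "i = Suc k" "j = Suc l" using \<open>i \<le> j\<close> by (metis Suc_le_D not0_implies_Suc)
        then show ?thesis
          using dist_iterates_le[of k "f z" l] c(3) that(1) by (simp add: funpow_swap1)
      qed
    qed
    have dist_le: "dist z ((f ^^ j) z) \<le> c" if "0 < j" for j
      using that
    proof (induction j rule: less_induct)
      case (less j)
      obtain m where m: "m < j" "(f ^^ j) z = f ((f ^^ m) z)" "0 < orbit_diam f ((f ^^ m) z)"
        using iterate_as_image_of_nonfixed[OF \<open>f z \<noteq> z\<close> less.prems] by blast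
      \<comment> \<open>By induction the iterates before \<open>m\<close> are within \<open>c < D\<close> of \<open>z\<close>, so the diameter \<open>D\<close> is due to the
        distances from \<open>z\<close> to the iterates from \<open>m\<close> on.  The orbit of \<open>f\<^sup>n x\<close> comes arbitrarily close
        to \<open>z\<close>, so the joint diameter is still at least \<open>D\<close>.\<close>
      have ge: "D \<le> orbit_diam2 f ((f ^^ n) x) ((f ^^ m) z)" (is "_ \<le> ?t") for n
      proof -
        have "D \<le> max c ?t"
        proof (rule D_le)
          fix i :: nat assume "0 < i"
          show "dist z ((f ^^ i) z) \<le> max c ?t"
          proof (cases "i < m")
            case True
            then show ?thesis using less.IH[of i] m(1) \<open>0 < i\<close> by (simp add: le_max_iff_disj)
          next
            case False
            then have "(f ^^ i) z = (f ^^ (i - m)) ((f ^^ m) z)"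
              by (simp add: funpow_funpow)
            then have "dist ((f ^^ (k + n)) x) ((f ^^ i) z) \<le> ?t" for k
              using dist_iterates_le2[of k "(f ^^ n) x" "i - m"] by (simp add: funpow_add)
            moreover have "(\<lambda>k. dist ((f ^^ (k + n)) x) ((f ^^ i) z)) \<longlonglongrightarrow> dist z ((f ^^ i) z)"
              by (intro tendsto_intros LIMSEQ_ignore_initial_segment lim)
            ultimately have "dist z ((f ^^ i) z) \<le> ?t" by (intro LIMSEQ_le_const2) auto
            then show ?thesis by simp
          qed
        qed simp
        then show ?thesis using \<open>c < D\<close> by simp
      qed
      have phi_tail: "\<phi> (orbit_diam f ((f ^^ m) z)) \<le> c"
      proof (cases m)
        case 0
        then show ?thesis using c(1) by (simp add: D_def)
      next
        case (Suc k)
        then have "orbit_diam f ((f ^^ m) z) \<le> c"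
          using orbit_diam_antimono[of 1 m z] c(3) by simp
        then show ?thesis using m(3) by (intro phi_le)
      qed
      have "eventually (\<lambda>n. orbit_diam f ((f ^^ n) x) < D / 2) sequentially"
        using order_tendstoD(2)[OF orbit_diam_tendsto_0, of "D / 2"] \<open>0 < D\<close> by simp
      with orbit_diam2_eventually_eq[OF lim \<open>f z \<noteq> z\<close> nonfixed]
      have "eventually (\<lambda>n. dist ((f ^^ Suc n) x) ((f ^^ j) z) \<le> c) sequentially"
      proof eventually_elim
        case (elim n)
        have pos: "0 < orbit_diam f ((f ^^ n) x)" using orbit_diam_pos nonfixed by blast
        have "orbit_diam2 f ((f ^^ n) x) ((f ^^ m) z) = D"
          using elim(1) orbit_diam2_antimono[of n n 0 m x z] ge[of n] by (simp add: D_def)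
        then have "dist (f ((f ^^ n) x)) (f ((f ^^ m) z)) \<le> c"
          using elim(2) pos m(3) tail_le[of m] phi_tail c
          by (intro dist_image_leI) (auto intro!: phi_le)
        then show ?case using m(2) by simp
      qed
      moreover have "(\<lambda>n. dist ((f ^^ Suc n) x) ((f ^^ j) z)) \<longlonglongrightarrow> dist z ((f ^^ j) z)"
        by (intro tendsto_intros LIMSEQ_Suc lim)
      ultimately show ?case
        by (intro tendsto_upperbound) (auto simp: trivial_limit_sequentially)
    qed
    then show False using D_le[of c] \<open>c < D\<close> by simp
  qed
qed

text \<open>For two fixed points the joint diameter is their distance, and the other arguments of \<open>\<phi>\<close> are 0.\<close>

lemma fixed_point_unique:
  assumes "\<phi> 0 = 0" "f y = y" "f z = z"
  shows "y = z"
proof (rule ccontr)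
  assume "y \<noteq> z"
  have "(f ^^ n) y = y" "(f ^^ n) z = z" for n by (induction n) (auto simp: assms)
  then have "orbit_diam2 f y z = dist y z"
    using dist_iterates_le2[of 0 y 0 z] assms fixed_iff_orbit_diam_0
    by (intro antisym orbit_diam2_leI) auto
  moreover have "0 \<le> \<phi> (dist y z)" using Phi by (simp add: Phi_def)
  moreover have "orbit_diam f y = 0" "orbit_diam f z = 0" using assms fixed_iff_orbit_diam_0 by auto
  ultimately have "dist (f y) (f z) \<le> \<phi> (dist y z)" using assms(1) by (intro dist_image_leI) auto
  then show False using phi_less[of "dist y z"] \<open>y \<noteq> z\<close> assms by simp
qed

end

section \<open>The fixed point theorem\<close>

theorem theorem12:
  fixes f :: "'a::complete_space \<Rightarrow> 'a" and \<phi> :: "real \<Rightarrow> real"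
  assumes "\<And>x. finite_orbit_diam f x"
    and "\<phi> \<in> Phi"
    and "gen_contraction_III \<phi> f"
  shows "(\<exists>z. f z = z) \<and>
         (\<phi> 0 = 0 \<longrightarrow> (\<exists>!z. f z = z)) \<and>
         (\<forall>x. \<exists>z. f z = z \<and> (\<lambda>n. (f ^^ n) x) \<longlonglongrightarrow> z)"
proof -
  interpret generalized_contraction f \<phi> using assms by unfold_locales
  have conv: "\<exists>z. f z = z \<and> (\<lambda>n. (f ^^ n) x) \<longlonglongrightarrow> z" for x
    using Cauchy_iterates[of x] limit_of_iterates_fixed unfolding Cauchy_convergent_iff convergent_def
    by blast
  then show ?thesis using fixed_point_unique by metis
qed

end
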